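(* Consider an instance of the node-weighted prize-collecting Steiner forest problem (setting and algorithm described in the context) with $h$ demands. The set $X$ output by the algorithm described in the context satisfies $\mathrm{pcsf}(X)\le 2H_{2h}\cdot \mathrm{OPT}$, where $H_{2h}=\sum_{j=1}^{2h} 1/j$ is the $(2h)$-th harmonic number and $\mathrm{OPT}$ is the optimal value of the instance; i.e., the algorithm has approximation ratio at most $2H_{2h}$.
   Context: Setting. $G=(V,E)$ is an undirected graph with vertex costs $c:V\to\mathbb{R}_{\ge 0}$; for $S\subseteq V$, $c(S)=\sum_{v\in S}c(v)$. A set of demands $\mathcal{L}=\langle (s_1,t_1),\dots,(s_h,t_h)\rangle$ is given, with penalty $\pi_i\ge 0$ for demand $i$. The endpoints $s_i,t_i$ are called terminals; $\mathcal{T}$ denotes the set of terminals. Standing assumptions: terminals have cost zero and all $2h$ endpoints are distinct. For $X\subseteq V$, $\mathrm{pcsf}(X)=c(X)+\sum_{i:\ s_i,t_i \text{ not connected in } G[X]}\pi_i$; the problem is to minimize $\mathrm{pcsf}(X)$. Notation. For a cost function $c'$, $d^{c'}(u,v)$ is the minimum, over $u$–$v$ paths, of the total $c'$-cost of the path's vertices, endpoints included. For $S\subseteq V$, $\delta(S)$ is the set of vertices not in $S$ having a neighbor in $S$. $S$ separates demand $i$ if exactly one of $s_i,t_i$ is in $S$; $\pi_{\mathcal{L}}(S)=\frac12\sum_{i\in\mathcal{L}:\ S\text{ separates } i}\pi_i$. For a cost function $c'$ and demand set $\mathcal{L}'$, let $Z_{c'}$ be the set of zero-cost vertices; a core is a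 connected component of $G[Z_{c'}]$ containing an endpoint of a demand of $\mathcal{L}'$. $\overline{\mathcal{S}}(c',\mathcal{L}')$ is the family of sets $S\subseteq V$ that contain exactly one core entirely and are disjoint from all other cores; $\mathrm{core}(S)$ denotes that core. The simplified dual $\overline{\mathcal{D}}(c',\mathcal{L}')$ has variables $y(S)\ge 0$ for $S\in\overline{\mathcal{S}}(c',\mathcal{L}')$, objective $\sum_S y(S)$, and constraints (C1) for every $v\in V$: $\sum_{S:\, v\in\delta(S)} y(S)\le c'(v)$; (C2) for every $S\in\overline{\mathcal{S}}(c',\mathcal{L}')$: $\sum_{S':\ \mathrm{core}(S)\subseteq S'\subseteq S} y(S')\le \pi_{\mathcal{L}'}(S)$. Disks. A disk of radius $R$ centered at terminal $t$ (w.r.t. $c',\mathcal{L}'$) is the vector $y$ produced by: start with $y=0$ and $S$ the core containing $t$; increase $y(S)$ continuously until constraint (C1) becomes tight for some vertex $u$; add $u$ to $S$ and repeat; stop when $\sum_S y(S)=R$. A vertex $v$ is inside the disk if $d^{c'}(t,v)<R$; the continent is the set of vertices inside; $v$ is on the boundary if it is not inside but has a neighbor $u$ with $d^{c'}(t,u)\le R$. The union of disks is the coordinatewise sum; disks are non-overlapping if their union is feasible for $\overline{\mathcal{D}}(c',\mathcal{L}')$. Algorithm. Set $X_0=\mathcal{T}$, $\mathcal{L}_1=\mathcal{L}$, $i=1$. While $\mathcal{L}_i\neq\emptyset$: let $c_i$ be $c$ with the costs of all vertices of $X_{i-1}$ set to $0$; consider the cores w.r.t. $c_i,\mathcal{L}_i$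 and let $T_i$ contain one arbitrary terminal from each core; let $R_i$ be the maximum radius such that the disks of radius $R_i$ (w.r.t. $c_i,\mathcal{L}_i$) centered at the terminals of $T_i$ are non-overlapping. If constraint (C2) is tight for the continent $S$ of one of these disks, set $X_i=X_{i-1}$ and remove from $\mathcal{L}_i$ every demand having an endpoint in $\mathrm{core}(S)$ to obtain $\mathcal{L}_{i+1}$. Otherwise, pick a vertex $v$ lying on the boundary of at least two of the disks for which (C1) is tight; let $L_v$ be the set of centers of disks whose boundary contains $v$; let $X_i$ be $X_{i-1}$ together with, for each $\tau\in L_v$, a shortest path w.r.t. $c_i$ between $\tau$ and $v$; set $\mathcal{L}_{i+1}=\mathcal{L}_i\setminus\{j: d^{c_{i+1}}(s_j,t_j)=0\}$. Increase $i$. When $\mathcal{L}_i=\emptyset$, output $X=X_{i-1}$.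
   Formalization: The algorithm starts from X_0 = terminals together with all zero-cost vertices (with terminals alone the bound fails if other zero-cost vertices exist), and a disk's continent also includes its core, which matters only for radius 0, where the algorithm would otherwise be stuck. *)

theory Defs
  imports "HOL-Analysis.Harmonic_Numbers" "HOL-Library.Extended_Real"
begin

text \<open>Demands are indexed by \<open>{1..h}\<close>, so demand sets are sets of natural numbers.\<close>

locale pcsf_instance =
  fixes V :: "'v set" and E :: "'v set set" and c :: "'v \<Rightarrow> real"
    and h :: nat and s t :: "nat \<Rightarrow> 'v" and \<pi> :: "nat \<Rightarrow> real"
  assumes finite_V: "finite V"
    and edges: "\<And>e. e \<in> E \<Longrightarrow> \<exists>u\<in>V. \<exists>v\<in>V. u \<noteq> v \<and> e = {u, v}"
    and cost_nonneg: "\<And>v. v \<in> V \<Longrightarrow> 0 \<le> c v"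
    and src_in_V: "\<And>i. i \<in> {1..h} \<Longrightarrow> s i \<in> V"
    and tgt_in_V: "\<And>i. i \<in> {1..h} \<Longrightarrow> t i \<in> V"
    and inj_src: "inj_on s {1..h}"
    and inj_tgt: "inj_on t {1..h}"
    and src_tgt_disjoint: "s ` {1..h} \<inter> t ` {1..h} = {}"
    and src_cost: "\<And>i. i \<in> {1..h} \<Longrightarrow> c (s i) = 0"
    and tgt_cost: "\<And>i. i \<in> {1..h} \<Longrightarrow> c (t i) = 0"
    and penalty_nonneg: "\<And>i. i \<in> {1..h} \<Longrightarrow> 0 \<le> \<pi> i"
begin

definition endpoints :: "nat set \<Rightarrow> 'v set" where
  "endpoints L = s ` L \<union> t ` L"

definition terminals :: "'v set" where
  "terminals = endpoints {1..h}"

definition paths_in :: "'v set \<Rightarrow> 'v \<Rightarrow> 'v \<Rightarrow> 'v list set" where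
  "paths_in U u v = {p. p \<noteq> [] \<and> hd p = u \<and> last p = v \<and> distinct p \<and> set p \<subseteq> U \<and>
     successively (\<lambda>x y. {x, y} \<in> E) p}"

definition connected_in :: "'v set \<Rightarrow> 'v \<Rightarrow> 'v \<Rightarrow> bool" where
  "connected_in U u v \<longleftrightarrow> paths_in U u v \<noteq> {}"

definition component :: "'v set \<Rightarrow> 'v \<Rightarrow> 'v set" where
  "component U u = {v. connected_in U u v}"

definition pcsf :: "'v set \<Rightarrow> real" where
  "pcsf X = (\<Sum>v\<in>X. c v) + (\<Sum>i | i \<in> {1..h} \<and> \<not> connected_in X (s i) (t i). \<pi> i)"

definition opt :: real where
  "opt = Min (pcsf ` Pow V)"

text \<open>The distance is \<open>\<infinity>\<close> if there is no path.\<close>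

definition vdist :: "('v \<Rightarrow> real) \<Rightarrow> 'v \<Rightarrow> 'v \<Rightarrow> ereal" where
  "vdist c' u v = (INF p \<in> paths_in V u v. ereal (\<Sum>x\<in>set p. c' x))"

definition shortest_path :: "('v \<Rightarrow> real) \<Rightarrow> 'v \<Rightarrow> 'v \<Rightarrow> 'v list \<Rightarrow> bool" where
  "shortest_path c' u v p \<longleftrightarrow>
     p \<in> paths_in V u v \<and> (\<forall>q \<in> paths_in V u v. (\<Sum>x\<in>set p. c' x) \<le> (\<Sum>x\<in>set q. c' x))"

definition \<delta> :: "'v set \<Rightarrow> 'v set" where
  "\<delta> S = {v \<in> V - S. \<exists>u\<in>S. {u, v} \<in> E}"

definition separates :: "'v set \<Rightarrow> nat \<Rightarrow> bool" where
  "separates S i \<longleftrightarrow> (s i \<in> S) \<noteq> (t i \<in> S)"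

definition half_penalty :: "nat set \<Rightarrow> 'v set \<Rightarrow> real" where
  "half_penalty L S = 1 / 2 * (\<Sum>i | i \<in> L \<and> separates S i. \<pi> i)"

definition zero_verts :: "('v \<Rightarrow> real) \<Rightarrow> 'v set" where
  "zero_verts c' = {v \<in> V. c' v = 0}"

definition cores :: "('v \<Rightarrow> real) \<Rightarrow> nat set \<Rightarrow> 'v set set" where
  "cores c' L = {C. (\<exists>u \<in> zero_verts c'. C = component (zero_verts c') u) \<and> C \<inter> endpoints L \<noteq> {}}"

definition core_family :: "('v \<Rightarrow> real) \<Rightarrow> nat set \<Rightarrow> 'v set set" where
  "core_family c' L =
     {S. S \<subseteq> V \<and> (\<exists>C \<in> cores c' L. C \<subseteq> S \<and> (\<forall>C' \<in> cores c' L - {C}. S \<inter> C' = {}))}"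

definition core_of :: "('v \<Rightarrow> real) \<Rightarrow> nat set \<Rightarrow> 'v set \<Rightarrow> 'v set" where
  "core_of c' L S = (THE C. C \<in> cores c' L \<and> C \<subseteq> S)"

text \<open>
  Dual vectors are functions on all vertex sets. A feasible vector vanishes outside
  \<^term>\<open>core_family c' L\<close>, so the sums below range over the variables of the dual only.
\<close>

definition load :: "('v set \<Rightarrow> real) \<Rightarrow> 'v \<Rightarrow> real" where
  "load y v = (\<Sum>S | S \<subseteq> V \<and> v \<in> \<delta> S. y S)"

definition core_load :: "('v \<Rightarrow> real) \<Rightarrow> nat set \<Rightarrow> ('v set \<Rightarrow> real) \<Rightarrow> 'v set \<Rightarrow> real" where
  "core_load c' L y S = (\<Sum>S' | core_of c' L S \<subseteq> S' \<and> S' \<subseteq> S. y S')"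

definition dual_feasible :: "('v \<Rightarrow> real) \<Rightarrow> nat set \<Rightarrow> ('v set \<Rightarrow> real) \<Rightarrow> bool" where
  "dual_feasible c' L y \<longleftrightarrow>
     (\<forall>S. 0 \<le> y S) \<and>
     (\<forall>S. S \<notin> core_family c' L \<longrightarrow> y S = 0) \<and>
     (\<forall>v\<in>V. load y v \<le> c' v) \<and>
     (\<forall>S \<in> core_family c' L. core_load c' L y S \<le> half_penalty L S)"

definition C1_tight :: "('v \<Rightarrow> real) \<Rightarrow> ('v set \<Rightarrow> real) \<Rightarrow> 'v \<Rightarrow> bool" where
  "C1_tight c' y v \<longleftrightarrow> load y v = c' v"

definition C2_tight :: "('v \<Rightarrow> real) \<Rightarrow> nat set \<Rightarrow> ('v set \<Rightarrow> real) \<Rightarrow> 'v set \<Rightarrow> bool" where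
  "C2_tight c' L y S \<longleftrightarrow> S \<in> core_family c' L \<and> core_load c' L y S = half_penalty L S"

text \<open>
  \<open>raise c' S y y'\<close>: increasing the variable of \<open>S\<close> leads from \<open>y\<close> to \<open>y'\<close> without
  passing the point where a vertex constraint becomes tight.
  \<open>disk_growth c' \<tau> S y\<close>: the growth process started at the core of \<open>\<tau>\<close> can reach the
  current set \<open>S\<close> and the vector \<open>y\<close>. Only vertices of \<^term>\<open>\<delta> S\<close> can stop the growth of \<open>S\<close>;
  if several become tight at once, they are added one after the other with increment \<open>0\<close>.
\<close>

definition raise :: "('v \<Rightarrow> real) \<Rightarrow> 'v set \<Rightarrow> ('v set \<Rightarrow> real) \<Rightarrow> ('v set \<Rightarrow> real) \<Rightarrow> bool" where
  "raise c' S y y' \<longleftrightarrow> (\<exists>\<epsilon>\<ge>0. y' = y(S := y S + \<epsilon>)) \<and> (\<forall>v\<in>V. load y' v \<le> c' v)"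

inductive disk_growth :: "('v \<Rightarrow> real) \<Rightarrow> 'v \<Rightarrow> 'v set \<Rightarrow> ('v set \<Rightarrow> real) \<Rightarrow> bool"
  for c' :: "'v \<Rightarrow> real" and \<tau> :: 'v where
  start: "disk_growth c' \<tau> (component (zero_verts c') \<tau>) (\<lambda>_. 0)"
| grow: "\<lbrakk>disk_growth c' \<tau> S y; raise c' S y y'; u \<in> \<delta> S; C1_tight c' y' u\<rbrakk>
    \<Longrightarrow> disk_growth c' \<tau> (insert u S) y'"

definition is_disk :: "('v \<Rightarrow> real) \<Rightarrow> 'v \<Rightarrow> real \<Rightarrow> ('v set \<Rightarrow> real) \<Rightarrow> bool" where
  "is_disk c' \<tau> R y \<longleftrightarrow>
     (\<exists>S y0. disk_growth c' \<tau> S y0 \<and> raise c' S y0 y) \<and> (\<Sum>S \<in> Pow V. y S) = R"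

definition inside :: "('v \<Rightarrow> real) \<Rightarrow> 'v \<Rightarrow> real \<Rightarrow> 'v set" where
  "inside c' \<tau> R = {v \<in> V. vdist c' \<tau> v < ereal R}"

text \<open>
  For \<open>R > 0\<close> the core of \<open>\<tau>\<close> lies inside the disk. Joining it matters only for the
  degenerate radius \<open>R = 0\<close>, where no vertex is inside and the growth process is still at the core.
\<close>

definition continent :: "('v \<Rightarrow> real) \<Rightarrow> 'v \<Rightarrow> real \<Rightarrow> 'v set" where
  "continent c' \<tau> R = component (zero_verts c') \<tau> \<union> inside c' \<tau> R"

definition boundary :: "('v \<Rightarrow> real) \<Rightarrow> 'v \<Rightarrow> real \<Rightarrow> 'v set" where
  "boundary c' \<tau> R =
     {v \<in> V. v \<notin> inside c' \<tau> R \<and> (\<exists>u\<in>V. {u, v} \<in> E \<and> vdist c' \<tau> u \<le> ereal R)}"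

definition is_disk_union :: "('v \<Rightarrow> real) \<Rightarrow> 'v set \<Rightarrow> real \<Rightarrow> ('v set \<Rightarrow> real) \<Rightarrow> bool" where
  "is_disk_union c' T R y \<longleftrightarrow>
     (\<exists>Y. (\<forall>\<tau>\<in>T. is_disk c' \<tau> R (Y \<tau>)) \<and> y = (\<lambda>S. \<Sum>\<tau>\<in>T. Y \<tau> S))"

definition non_overlapping :: "('v \<Rightarrow> real) \<Rightarrow> nat set \<Rightarrow> 'v set \<Rightarrow> real \<Rightarrow> bool" where
  "non_overlapping c' L T R \<longleftrightarrow> (\<exists>y. is_disk_union c' T R y \<and> dual_feasible c' L y)"

definition max_radius :: "('v \<Rightarrow> real) \<Rightarrow> nat set \<Rightarrow> 'v set \<Rightarrow> real \<Rightarrow> bool" where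
  "max_radius c' L T R \<longleftrightarrow>
     non_overlapping c' L T R \<and> (\<forall>r. non_overlapping c' L T r \<longrightarrow> r \<le> R)"

definition core_representatives :: "('v \<Rightarrow> real) \<Rightarrow> nat set \<Rightarrow> 'v set \<Rightarrow> bool" where
  "core_representatives c' L T \<longleftrightarrow>
     T \<subseteq> terminals \<inter> \<Union> (cores c' L) \<and> (\<forall>C \<in> cores c' L. \<exists>!\<tau>. \<tau> \<in> T \<inter> C)"

definition residual_cost :: "'v set \<Rightarrow> 'v \<Rightarrow> real" where
  "residual_cost X v = (if v \<in> X then 0 else c v)"

text \<open>
  The dual vector \<open>y\<close> of an iteration: the union of the disks of maximum radius \<open>R\<close> around a
  choice \<open>T\<close> of centers. Feasibility of \<open>y\<close> is repeated here because \<^const>\<open>is_disk_union\<close> is a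
  relation.
\<close>

definition iteration_disks ::
    "('v \<Rightarrow> real) \<Rightarrow> nat set \<Rightarrow> 'v set \<Rightarrow> real \<Rightarrow> ('v set \<Rightarrow> real) \<Rightarrow> bool" where
  "iteration_disks c' L T R y \<longleftrightarrow>
     core_representatives c' L T \<and> max_radius c' L T R \<and>
     is_disk_union c' T R y \<and> dual_feasible c' L y"

text \<open>
  All choices of the algorithm are nondeterministic: \<open>reachable X L\<close> holds if some execution
  reaches a state with selected vertices \<open>X\<close> and remaining demands \<open>L\<close>.

  The zero-cost vertices, which are free, are selected from the start. If only terminals have
  cost zero, the initial set is exactly the set of terminals. Starting from the terminals alone
  in the presence of other zero-cost vertices would break the guarantee: on a path
  \<open>s\<^sub>1, z, t\<^sub>1\<close> with \<open>c z = 0\<close>, all three vertices form one core, the demand is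
  discarded and \<open>z\<close> is never selected, so the penalty is paid although the optimum is \<open>0\<close>.
\<close>

inductive reachable :: "'v set \<Rightarrow> nat set \<Rightarrow> bool" where
  init: "reachable (terminals \<union> zero_verts c) {1..h}"
| discard:
    "\<lbrakk>reachable X L; L \<noteq> {}; c' = residual_cost X; iteration_disks c' L T R y;
      \<tau> \<in> T; S = continent c' \<tau> R; C2_tight c' L y S;
      L' = L - {j. s j \<in> core_of c' L S \<or> t j \<in> core_of c' L S}\<rbrakk>
    \<Longrightarrow> reachable X L'"
| connect:
    "\<lbrakk>reachable X L; L \<noteq> {}; c' = residual_cost X; iteration_disks c' L T R y;
      \<forall>\<tau>\<in>T. \<not> C2_tight c' L y (continent c' \<tau> R);
      v \<in> V; C1_tight c' y v; Lv = {\<tau> \<in> T. v \<in> boundary c' \<tau> R}; 2 \<le> card Lv;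
      \<forall>\<tau>\<in>Lv. shortest_path c' \<tau> v (P \<tau>);
      X' = X \<union> (\<Union>\<tau>\<in>Lv. set (P \<tau>));
      L' = L - {j. vdist (residual_cost X') (s j) (t j) = 0}\<rbrakk>
    \<Longrightarrow> reachable X' L'"

definition algorithm_output :: "'v set \<Rightarrow> bool" where
  "algorithm_output X \<longleftrightarrow> reachable X {}"

end

end

theory Submission imports Defs begin

text \<open>
  The disks of an iteration with \<open>n\<close> cores form a feasible dual solution of value \<open>n R\<close>, so weak
  duality gives \<open>R \<le> OPT / n\<close>. Discarding a core costs at most \<open>2 R\<close> in penalties and removes one
  core; joining the \<open>m \<ge> 2\<close> disks that touch a tight vertex costs at most \<open>m R\<close> and removes
  \<open>m - 1 \<ge> m / 2\<close> cores. Either way the price is at most \<open>2 OPT / n\<close> per removed core, and there are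
  at most \<open>2 h\<close> cores initially, so the payments sum to at most \<open>2 H\<^sub>2\<^sub>h OPT\<close>.
\<close>

text \<open>The factor 2 has two sources, one for each kind of step. Constraint (C2) carries half a
  penalty because a demand can be charged at the cores of both of its endpoints; a tight (C2)
  therefore accounts for only half of the penalties that are given up. For joined disks the factor
  is \<open>m / (m - 1)\<close>. The delicate estimate is the price \<open>m R\<close> of joining.
  All \<open>m\<close> paths end in the same tight vertex \<open>v\<close>, whose cost must be
  covered by the loads that these \<open>m\<close> disks put on it, so no other disk may load
  \<open>v\<close>. A disk loads only vertices inside it or on its boundary, and \<open>v\<close>
  cannot be inside another disk because dual feasibility keeps any two centers at distance at least
  \<open>2 R\<close>. Disks are given by a growth relation rather than by a formula, so what is
  known about their loads comes from an invariant of the growth process. Optima are not compared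
  between iterations: each residual dual is bounded directly by the value of an optimal set of the
  original instance.\<close>

lemma sum_UNION_le:
  fixes f :: "'a \<Rightarrow> real"
  assumes "finite I" "\<And>i. i \<in> I \<Longrightarrow> finite (A i)" "\<And>i x. i \<in> I \<Longrightarrow> x \<in> A i \<Longrightarrow> 0 \<le> f x"
  shows "(\<Sum>x\<in>(\<Union>i\<in>I. A i). f x) \<le> (\<Sum>i\<in>I. \<Sum>x\<in>A i. f x)"
  using assms
proof (induction I rule: finite_induct)
  case (insert j J)
  have "(\<Sum>x\<in>(\<Union>i\<in>insert j J. A i). f x)
      = (\<Sum>x\<in>A j. f x) + (\<Sum>x\<in>(\<Union>i\<in>J. A i). f x) - (\<Sum>x\<in>A j \<inter> (\<Union>i\<in>J. A i). f x)"
    using insert by (simp add: sum_Un)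
  moreover have "0 \<le> (\<Sum>x\<in>A j \<inter> (\<Union>i\<in>J. A i). f x)"
    using insert by (intro sum_nonneg) auto
  moreover have "(\<Sum>x\<in>(\<Union>i\<in>J. A i). f x) \<le> (\<Sum>i\<in>J. \<Sum>x\<in>A i. f x)"
    using insert by blast
  ultimately show ?case using insert by simp
qed simp

text \<open>Each of the \<open>n - a\<close> reciprocals in the difference is at least
  \<open>1 / n\<close>. Prices proportional to \<open>1 / n\<close> per removed core thereby
  telescope to a harmonic number.\<close>

lemma harm_diff_ge:
  assumes "a \<le> n"
  shows "real (n - a) / real n \<le> harm n - (harm a :: real)"
proof -
  have "real (n - a) / real n = (\<Sum>k\<in>{Suc a..n}. inverse (real n))"
    by (simp add: field_simps)
  also have "\<dots> \<le> (\<Sum>k\<in>{Suc a..n}. inverse (real k))"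
    by (intro sum_mono le_imp_inverse_le) auto
  also have "\<dots> = harm n - harm a"
  proof -
    have "{1..n} = {1..a} \<union> {Suc a..n}" using assms by auto
    then have "harm n = (\<Sum>k\<in>{1..a} \<union> {Suc a..n}. inverse (real k))"
      unfolding harm_def by simp
    also have "\<dots> = harm a + (\<Sum>k\<in>{Suc a..n}. inverse (real k))"
      unfolding harm_def by (rule sum.union_disjoint) auto
    finally show ?thesis by simp
  qed
  finally show ?thesis .
qed

context pcsf_instance
begin

section \<open>Paths and connectivity\<close>

lemma edge_in_V: "{x, y} \<in> E \<Longrightarrow> x \<in> V \<and> y \<in> V"
  using edges[of "{x, y}"] by (auto simp: doubleton_eq_iff)

lemma path_prefix:
  assumes "p \<in> paths_in U a b" "x \<in> set p"
  shows "\<exists>q\<in>paths_in U a x. set q \<subseteq> set p"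
proof -
  obtain xs ys where p: "p = xs @ x # ys"
    using assms(2) by (auto dest: split_list)
  have "xs @ [x] \<in> paths_in U a x"
    using assms(1) unfolding paths_in_def p
    by (auto simp: successively_append_iff hd_append split: if_splits)
  then show ?thesis
    by (rule bexI[rotated]) (auto simp: p)
qed

text \<open>Paths are distinct lists, so if \<open>v\<close> already occurs the path is cut there
  instead. The inclusion of vertex sets is enough to compare nonnegative costs.\<close>

lemma path_append:
  assumes "p \<in> paths_in U a w" "{w, v} \<in> E" "v \<in> U"
  shows "\<exists>q\<in>paths_in U a v. set q \<subseteq> insert v (set p)"
proof (cases "v \<in> set p")
  case True
  then show ?thesis using path_prefix[OF assms(1) True] by blast
next
  case False
  have "p @ [v] \<in> paths_in U a v"
    using assms False unfolding paths_in_def by (auto simp: successively_append_iff)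
  then show ?thesis by (rule bexI[rotated]) auto
qed

lemma connected_in_refl: "u \<in> U \<Longrightarrow> connected_in U u u"
  unfolding connected_in_def paths_in_def by (auto intro: exI[of _ "[u]"])

lemma connected_in_mem: "connected_in U a b \<Longrightarrow> a \<in> U \<and> b \<in> U"
  unfolding connected_in_def paths_in_def by (auto dest: hd_in_set last_in_set)

lemma connected_in_mono: "connected_in U a b \<Longrightarrow> U \<subseteq> W \<Longrightarrow> connected_in W a b"
  unfolding connected_in_def paths_in_def by blast

lemma connected_in_step: "connected_in U a b \<Longrightarrow> {b, d} \<in> E \<Longrightarrow> d \<in> U \<Longrightarrow> connected_in U a d"
  using path_append[of _ U a b d] unfolding connected_in_def by blast

text \<open>Replaces the list of a path by closure under edges inside \<open>U\<close>;
  transitivity, symmetry and the crossing of cuts follow from it.\<close>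

lemma connected_in_induct [consumes 1, case_names base step]:
  assumes "connected_in U a b" "P a"
    and step: "\<And>x y. x \<in> U \<Longrightarrow> y \<in> U \<Longrightarrow> {x, y} \<in> E \<Longrightarrow> P x \<Longrightarrow> P y"
  shows "P b"
proof -
  have "P (last p)" if "p \<noteq> []" "P (hd p)" "set p \<subseteq> U" "successively (\<lambda>x y. {x, y} \<in> E) p" for p
    using that
  proof (induction p rule: induct_list012)
    case (3 x y zs)
    have "P y" by (rule step[of x y]) (use 3 in auto)
    then show ?case using 3 by auto
  qed auto
  then show ?thesis
    using assms(1,2) unfolding connected_in_def paths_in_def by blast
qed

lemma connected_in_trans:
  assumes "connected_in U a b" "connected_in U b d"
  shows "connected_in U a d"
  using assms(2,1) by (induction rule: connected_in_induct) (auto intro: connected_in_step)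

lemma connected_in_sym:
  assumes "connected_in U a b"
  shows "connected_in U b a"
  using assms
proof (induction rule: connected_in_induct)
  case base
  then show ?case using connected_in_mem[OF assms] by (auto intro: connected_in_refl)
next
  case (step x y)
  have "connected_in U y x"
    by (rule connected_in_step[OF connected_in_refl]) (use step in \<open>auto simp: insert_commute\<close>)
  then show ?case using step connected_in_trans by blast
qed

text \<open>If \<open>\<delta> S\<close> misses \<open>U\<close>, membership in \<open>S\<close>
  propagates along every edge inside \<open>U\<close>. This cut argument serves both weak duality
  and the distance between centers.\<close>

lemma connected_in_crossing:
  assumes "connected_in U a b" "a \<in> S" "b \<notin> S" "U \<subseteq> V"
  shows "\<delta> S \<inter> U \<noteq> {}"
proof
  assume *: "\<delta> S \<inter> U = {}"
  from assms(1) have "b \<in> S"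
  proof (induction rule: connected_in_induct)
    case (step x y)
    then show ?case using * assms(4) unfolding \<delta>_def by blast
  qed fact
  with assms(3) show False by simp
qed

lemma path_connected_in:
  assumes "p \<in> paths_in U a b" "set p \<subseteq> W"
  shows "connected_in W a b"
  using assms unfolding connected_in_def paths_in_def by auto

lemma component_eq: "connected_in U a b \<Longrightarrow> component U a = component U b"
  unfolding component_def using connected_in_trans connected_in_sym by blast

text \<open>Distinctness bounds the length by \<open>card V\<close>. Finiteness turns the infimum in
  \<open>vdist\<close> into a minimum, so a finite distance is realised by a path.\<close>

lemma finite_paths_in: "finite (paths_in V a b)"
proof -
  have "paths_in V a b \<subseteq> {p. set p \<subseteq> V \<and> length p \<le> card V}"
    unfolding paths_in_def using finite_V by (auto simp: distinct_card[symmetric] card_mono)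
  then show ?thesis using finite_lists_length_le[OF finite_V] finite_subset by blast
qed

lemma vdist_attained:
  assumes "vdist d a b < \<infinity>"
  shows "\<exists>p\<in>paths_in V a b. vdist d a b = ereal (\<Sum>x\<in>set p. d x)"
proof -
  have ne: "paths_in V a b \<noteq> {}"
    using assms unfolding vdist_def by (auto simp: top_ereal_def)
  have "vdist d a b = Min ((\<lambda>p. ereal (\<Sum>x\<in>set p. d x)) ` paths_in V a b)"
    unfolding vdist_def using ne finite_paths_in by (simp add: cInf_eq_Min)
  moreover have "\<dots> \<in> (\<lambda>p. ereal (\<Sum>x\<in>set p. d x)) ` paths_in V a b"
    using ne finite_paths_in by (intro Min_in) auto
  ultimately show ?thesis by auto
qed

lemma vdist_le: "p \<in> paths_in V a b \<Longrightarrow> vdist d a b \<le> ereal (\<Sum>x\<in>set p. d x)"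
  unfolding vdist_def by (rule INF_lower)

section \<open>Cores\<close>

lemma zero_verts_subset: "zero_verts d \<subseteq> V"
  unfolding zero_verts_def by auto

lemma core_eq_component: "C \<in> cores d L \<Longrightarrow> x \<in> C \<Longrightarrow> C = component (zero_verts d) x"
  unfolding cores_def using component_eq by (auto simp: component_def)

lemma core_subset: "C \<in> cores d L \<Longrightarrow> C \<subseteq> zero_verts d"
  unfolding cores_def component_def using connected_in_mem by blast

lemma cores_disjoint: "C \<in> cores d L \<Longrightarrow> C' \<in> cores d L \<Longrightarrow> x \<in> C \<Longrightarrow> x \<in> C' \<Longrightarrow> C = C'"
  using core_eq_component by metis

lemma finite_cores: "finite (cores d L)"
  by (rule finite_subset[of _ "Pow V"])
    (use core_subset zero_verts_subset finite_V in \<open>blast intro: finite_Pow_iff[THEN iffD2]\<close>)+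

lemma in_component_self: "u \<in> zero_verts d \<Longrightarrow> u \<in> component (zero_verts d) u"
  unfolding component_def using connected_in_refl by simp

lemma endpoint_core:
  assumes "u \<in> endpoints L" "u \<in> zero_verts d"
  shows "component (zero_verts d) u \<in> cores d L"
  unfolding cores_def using assms in_component_self by blast

lemma core_family_unique:
  assumes "S \<in> core_family d L" "C \<in> cores d L" "C' \<in> cores d L" "S \<inter> C \<noteq> {}" "S \<inter> C' \<noteq> {}"
  shows "C = C'"
  using assms unfolding core_family_def by blast

lemma core_nonempty: "C \<in> cores d L \<Longrightarrow> C \<noteq> {}"
  unfolding cores_def by blast

lemma core_of_eq:
  assumes "S \<in> core_family d L" "C \<in> cores d L" "C \<subseteq> S"
  shows "core_of d L S = C"
  unfolding core_of_def
proof (rule the_equality)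
  fix C' assume "C' \<in> cores d L \<and> C' \<subseteq> S"
  then show "C' = C"
    using core_family_unique[OF assms(1)] assms core_nonempty by (metis inf.absorb2)
qed (use assms in auto)

lemma core_of_core:
  assumes "S \<in> core_family d L"
  shows "core_of d L S \<in> cores d L \<and> core_of d L S \<subseteq> S"
proof -
  obtain C where "C \<in> cores d L" "C \<subseteq> S"
    using assms unfolding core_family_def by blast
  then show ?thesis using core_of_eq[OF assms] by metis
qed

section \<open>Weak duality\<close>

lemma hitting_sum_le_load:
  assumes "\<And>S. 0 \<le> y S" "finite U"
  shows "(\<Sum>S | S \<subseteq> V \<and> \<delta> S \<inter> U \<noteq> {}. y S) \<le> (\<Sum>v\<in>U. load y v)"
proof -
  have fin: "finite {S. S \<subseteq> V \<and> P S}" for P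
    using finite_V by auto
  have "(\<Sum>S | S \<subseteq> V \<and> \<delta> S \<inter> U \<noteq> {}. y S) = (\<Sum>S\<in>(\<Union>v\<in>U. {S. S \<subseteq> V \<and> v \<in> \<delta> S}). y S)"
    by (rule sum.cong) auto
  also have "\<dots> \<le> (\<Sum>v\<in>U. \<Sum>S | S \<subseteq> V \<and> v \<in> \<delta> S. y S)"
    using assms fin by (intro sum_UNION_le) auto
  finally show ?thesis unfolding load_def .
qed

text \<open>The value of \<open>y\<close> is split by whether \<open>\<delta> S\<close> meets
  \<open>U\<close>, which is \<open>X\<close> enlarged by vertices of cost zero. Sets that are hit
  are paid by costs through (C1). The others are grouped by core and paid by penalties through
  (C2).\<close>

lemma weak_duality:
  assumes feas: "dual_feasible d L y" and L: "L \<subseteq> {1..h}" and X: "X \<subseteq> V"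
    and ends: "endpoints L \<subseteq> zero_verts d"
  shows "(\<Sum>S\<in>Pow V. y S)
    \<le> (\<Sum>v\<in>X. d v) + (\<Sum>i | i \<in> L \<and> \<not> connected_in X (s i) (t i). \<pi> i)"
proof -
  define Z where "Z = zero_verts d"
  define U where "U = X \<union> Z"
  define N where "N = {i \<in> L. \<not> connected_in U (s i) (t i)}"
  define B where "B = {S \<in> core_family d L. \<delta> S \<inter> U = {}}"
  define sep where "sep C i \<longleftrightarrow> (s i \<in> C) \<noteq> (t i \<in> C)" for C i
  have nn: "0 \<le> y S" and out: "S \<notin> core_family d L \<Longrightarrow> y S = 0" for S
    using feas unfolding dual_feasible_def by auto
  have UV: "U \<subseteq> V" using X zero_verts_subset unfolding U_def Z_def by auto
  have finL: "finite L" using L finite_subset by blast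
  have pin: "0 \<le> \<pi> i" if "i \<in> L" for i using that L penalty_nonneg by blast
  have finB: "finite B"
    by (rule finite_subset[of _ "Pow V"]) (auto simp: B_def core_family_def finite_V)

  have sZ: "s i \<in> Z" and tZ: "t i \<in> Z" if "i \<in> L" for i
    using that ends unfolding Z_def endpoints_def by auto

  have "(\<Sum>S | S \<subseteq> V \<and> \<delta> S \<inter> U \<noteq> {}. y S) \<le> (\<Sum>v\<in>U. load y v)"
    using nn UV finite_V finite_subset by (intro hitting_sum_le_load) auto
  also have "\<dots> \<le> (\<Sum>v\<in>U. d v)"
    using feas UV unfolding dual_feasible_def by (intro sum_mono) auto
  also have "\<dots> = (\<Sum>v\<in>X. d v)"
    using UV finite_V finite_subset
    by (intro sum.mono_neutral_right) (auto simp: U_def Z_def zero_verts_def)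
  finally have hit: "(\<Sum>S | S \<subseteq> V \<and> \<delta> S \<inter> U \<noteq> {}. y S) \<le> (\<Sum>v\<in>X. d v)" .

  have per_core: "(\<Sum>S | S \<in> B \<and> core_of d L S = C. y S) \<le> 1/2 * (\<Sum>i | i \<in> N \<and> sep C i. \<pi> i)"
    if C: "C \<in> cores d L" for C
  proof (cases "{S. S \<in> B \<and> core_of d L S = C} = {}")
    \<comment> \<open>The union formed in the other case needs at least one member in order to
      contain \<open>C\<close>.\<close>
    case True
    have "0 \<le> (\<Sum>i | i \<in> N \<and> sep C i. \<pi> i)"
      by (rule sum_nonneg) (auto simp: N_def pin)
    with True show ?thesis unfolding True by simp
  next
    case False
    define F where "F = {S. S \<in> B \<and> core_of d L S = C}"
    \<comment> \<open>The union still has core \<open>C\<close> and still has no vertex of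
      \<open>U\<close> in its neighborhood. Hence the single constraint (C2) for \<open>W\<close>
      bounds all values in \<open>F\<close> together.\<close>
    define W where "W = \<Union>F"
    have FB: "S \<in> core_family d L" "\<delta> S \<inter> U = {}" "C \<subseteq> S" "S \<subseteq> V" if "S \<in> F" for S
      using that core_of_core[of S d L] unfolding F_def B_def core_family_def by auto
    have CW: "C \<subseteq> W" using False FB(3) unfolding W_def F_def by blast
    have other: "W \<inter> C' = {}" if "C' \<in> cores d L" "C' \<noteq> C" for C'
    proof -
      have "S \<inter> C' = {}" if "S \<in> F" for S
        using FB[OF that] core_family_unique[of S d L C C'] C core_nonempty[OF C] \<open>C' \<in> _\<close> \<open>C' \<noteq> C\<close>
        by blast
      then show ?thesis unfolding W_def by blast
    qed
    have W: "W \<in> core_family d L"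
      unfolding core_family_def using CW other C FB(4) W_def by blast
    have cW: "core_of d L W = C" using core_of_eq[OF W C CW] .
    have WV: "W \<subseteq> V" using FB(4) W_def by blast
    have dW: "\<delta> W \<inter> U = {}" using FB(2) unfolding \<delta>_def W_def by blast
    have "(\<Sum>S\<in>F. y S) \<le> core_load d L y W"
      unfolding core_load_def cW
    proof (rule sum_mono2)
      show "finite {S'. C \<subseteq> S' \<and> S' \<subseteq> W}"
        by (rule finite_subset[of _ "Pow V"]) (use WV finite_V in auto)
      show "F \<subseteq> {S'. C \<subseteq> S' \<and> S' \<subseteq> W}" using FB(3) W_def by blast
    qed (simp add: nn)
    also have "\<dots> \<le> half_penalty L W"
      using feas W unfolding dual_feasible_def by blast
    also have "\<dots> \<le> 1/2 * (\<Sum>i | i \<in> N \<and> sep C i. \<pi> i)"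
    proof -
      \<comment> \<open>Every endpoint of a demand in \<open>L\<close> lies in some core, and
        \<open>W\<close> meets no core other than \<open>C\<close>.\<close>
      have in_C: "x \<in> C" if "x \<in> W" "x \<in> endpoints L" for x
      proof -
        have "component Z x \<in> cores d L" "x \<in> component Z x"
          using endpoint_core in_component_self that ends unfolding Z_def by blast+
        then show ?thesis using other[of "component Z x"] that by auto
      qed
      have "{i. i \<in> L \<and> separates W i} \<subseteq> {i. i \<in> N \<and> sep C i}"
      proof safe
        fix i assume i: "i \<in> L" "separates W i"
        have e: "s i \<in> endpoints L" "t i \<in> endpoints L" using i unfolding endpoints_def by auto
        show "sep C i"
          using i in_C e CW unfolding sep_def separates_def by blast
        show "i \<in> N"
          unfolding N_def
        proof (safe, fact)
          assume con: "connected_in U (s i) (t i)"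
          show False
            using connected_in_crossing[OF con _ _ UV, of W]
              connected_in_crossing[OF connected_in_sym[OF con] _ _ UV, of W] i dW
            unfolding separates_def by blast
        qed
      qed
      then show ?thesis
        unfolding half_penalty_def using finL pin
        by (intro mult_left_mono sum_mono2) (auto simp: N_def)
    qed
    finally show ?thesis unfolding F_def .
  qed

  have "(\<Sum>S\<in>B. y S) = (\<Sum>C\<in>cores d L. \<Sum>S | S \<in> B \<and> core_of d L S = C. y S)"
    using finB finite_cores core_of_core
    by (intro sum.group[symmetric]) (auto simp: B_def)
  also have "\<dots> \<le> (\<Sum>C\<in>cores d L. 1/2 * (\<Sum>i | i \<in> N \<and> sep C i. \<pi> i))"
    by (rule sum_mono) (rule per_core)
  also have "\<dots> = 1/2 * (\<Sum>i\<in>N. \<Sum>C | C \<in> cores d L \<and> sep C i. \<pi> i)"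
    using finL finite_cores
    by (subst sum.swap_restrict) (auto simp: N_def sum_distrib_left)
  also have "\<dots> \<le> 1/2 * (\<Sum>i\<in>N. 2 * \<pi> i)"
  proof (intro mult_left_mono sum_mono)
    fix i assume i: "i \<in> N"
    \<comment> \<open>Cores are components, so only those of \<open>s i\<close> and
      \<open>t i\<close> can contain exactly one endpoint of \<open>i\<close>. The resulting factor
      2 cancels the half in (C2).\<close>
    have "{C. C \<in> cores d L \<and> sep C i} \<subseteq> {component Z (s i), component Z (t i)}"
      using core_eq_component unfolding sep_def Z_def by blast
    then have "card {C. C \<in> cores d L \<and> sep C i} \<le> card {component Z (s i), component Z (t i)}"
      by (intro card_mono) auto
    also have "\<dots> \<le> 2" by (simp add: card_insert_if)
    finally show "(\<Sum>C | C \<in> cores d L \<and> sep C i. \<pi> i) \<le> 2 * \<pi> i"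
      using i pin[of i] by (auto simp: N_def intro!: mult_right_mono)
  qed auto
  also have "\<dots> = (\<Sum>i\<in>N. \<pi> i)" by (simp add: sum_distrib_left[symmetric])
  also have "\<dots> \<le> (\<Sum>i | i \<in> L \<and> \<not> connected_in X (s i) (t i). \<pi> i)"
    using finL pin connected_in_mono[of X _ _ U]
    by (intro sum_mono2) (auto simp: N_def U_def)
  finally have miss: "(\<Sum>S\<in>B. y S) \<le> \<dots>" .

  have "(\<Sum>S\<in>Pow V. y S) = (\<Sum>S\<in>{S. S \<subseteq> V \<and> \<delta> S \<inter> U \<noteq> {}} \<union> B. y S)"
    using finite_V
    by (intro sum.mono_neutral_right) (auto simp: B_def core_family_def intro!: out)
  also have "\<dots> = (\<Sum>S | S \<subseteq> V \<and> \<delta> S \<inter> U \<noteq> {}. y S) + (\<Sum>S\<in>B. y S)"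
    using finite_V finB by (intro sum.union_disjoint) (auto simp: B_def)
  finally show ?thesis using hit miss by linarith
qed

section \<open>Disks\<close>

text \<open>
  A vertex of \<^term>\<open>\<delta> S\<close> has been loaded by every set raised since it became adjacent to the growing
  set, so its load plus its distance from \<open>\<tau>\<close> (its own cost excluded) is at most the current radius.
\<close>

definition disk_invariant :: "('v \<Rightarrow> real) \<Rightarrow> 'v \<Rightarrow> 'v set \<Rightarrow> ('v set \<Rightarrow> real) \<Rightarrow> bool" where
  "disk_invariant d \<tau> S y \<longleftrightarrow>
     S \<subseteq> V \<and> component (zero_verts d) \<tau> \<subseteq> S \<and>
     (\<forall>S'. 0 \<le> y S') \<and> (\<forall>S'. y S' \<noteq> 0 \<longrightarrow> component (zero_verts d) \<tau> \<subseteq> S') \<and>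
     (\<forall>v\<in>V. load y v \<le> d v) \<and>
     (\<forall>v\<in>S. \<exists>p\<in>paths_in V \<tau> v. (\<Sum>x\<in>set p. d x) \<le> (\<Sum>S'\<in>Pow V. y S')) \<and>
     (\<forall>v\<in>\<delta> S. \<exists>w. {w, v} \<in> E \<and>
        (\<exists>p\<in>paths_in V \<tau> w. (\<Sum>x\<in>set p. d x) + load y v \<le> (\<Sum>S'\<in>Pow V. y S'))) \<and>
     (\<forall>v\<in>V - S - \<delta> S. load y v = 0)"

lemma load_upd:
  assumes "S \<subseteq> V"
  shows "load (y(S := y S + e)) v = load y v + (if v \<in> \<delta> S then e else 0)"
proof -
  have fin: "finite {S'. S' \<subseteq> V \<and> v \<in> \<delta> S'}" using finite_V by auto
  have "load (y(S := y S + e)) v = (\<Sum>S' | S' \<subseteq> V \<and> v \<in> \<delta> S'. y S' + (if S' = S then e else 0))"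
    unfolding load_def by (rule sum.cong) auto
  also have "\<dots> = load y v + (if v \<in> \<delta> S then e else 0)"
    unfolding load_def sum.distrib using assms fin by (simp add: sum.delta)
  finally show ?thesis .
qed

lemma total_upd:
  assumes "S \<subseteq> V"
  shows "(\<Sum>S'\<in>Pow V. (y(S := y S + e)) S') = (\<Sum>S'\<in>Pow V. y S') + (e :: real)"
proof -
  have "(\<Sum>S'\<in>Pow V. (y(S := y S + e)) S') = (\<Sum>S'\<in>Pow V. y S' + (if S' = S then e else 0))"
    by (rule sum.cong) auto
  also have "\<dots> = (\<Sum>S'\<in>Pow V. y S') + e"
    unfolding sum.distrib using assms finite_V by (simp add: sum.delta)
  finally show ?thesis .
qed

text \<open>The increment enters the total and the load of each vertex of \<open>\<delta> S\<close>
  equally, so both sides of the path inequality move together; all other loads stay fixed.\<close>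

lemma disk_invariant_raise:
  assumes inv: "disk_invariant d \<tau> S y" and r: "raise d S y y'"
  shows "disk_invariant d \<tau> S y'"
proof -
  obtain e where e: "0 \<le> e" "y' = y(S := y S + e)" and le: "\<forall>v\<in>V. load y' v \<le> d v"
    using r unfolding raise_def by blast
  have SV: "S \<subseteq> V" using inv unfolding disk_invariant_def by blast
  have l: "load y' v = load y v + (if v \<in> \<delta> S then e else 0)" for v
    unfolding e by (rule load_upd[OF SV])
  have tot: "(\<Sum>S'\<in>Pow V. y' S') = (\<Sum>S'\<in>Pow V. y S') + e"
    unfolding e(2) by (rule total_upd[OF SV])
  show ?thesis
    unfolding disk_invariant_def tot
  proof (intro conjI)
    show "S \<subseteq> V" "component (zero_verts d) \<tau> \<subseteq> S"
      using inv unfolding disk_invariant_def by auto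
    show "\<forall>S'. 0 \<le> y' S'"
      using inv e unfolding disk_invariant_def by auto
    show "\<forall>S'. y' S' \<noteq> 0 \<longrightarrow> component (zero_verts d) \<tau> \<subseteq> S'"
      using inv e unfolding disk_invariant_def by auto
    show "\<forall>v\<in>V. load y' v \<le> d v" by (rule le)
    show "\<forall>v\<in>S. \<exists>p\<in>paths_in V \<tau> v. (\<Sum>x\<in>set p. d x) \<le> (\<Sum>S'\<in>Pow V. y S') + e"
      using inv e(1) unfolding disk_invariant_def by (meson add_increasing2)
    show "\<forall>v\<in>\<delta> S. \<exists>w. {w, v} \<in> E \<and>
        (\<exists>p\<in>paths_in V \<tau> w. (\<Sum>x\<in>set p. d x) + load y' v \<le> (\<Sum>S'\<in>Pow V. y S') + e)"
      using inv unfolding disk_invariant_def by (simp add: l add.assoc[symmetric])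
    show "\<forall>v\<in>V - S - \<delta> S. load y' v = 0"
      using inv unfolding disk_invariant_def by (simp add: l)
  qed
qed

text \<open>Tightness replaces the load of \<open>u\<close> by its cost, which turns the inequality
  at its neighbor into a path to \<open>u\<close> within the radius. A vertex that becomes adjacent
  only now has load zero, so this same path serves it.\<close>

lemma disk_invariant_grow:
  assumes inv: "disk_invariant d \<tau> S y" and u: "u \<in> \<delta> S" and tight: "C1_tight d y u"
    and nn: "\<And>v. v \<in> V \<Longrightarrow> 0 \<le> d v"
  shows "disk_invariant d \<tau> (insert u S) y"
proof -
  let ?tot = "\<Sum>S'\<in>Pow V. y S'"
  have uV: "u \<in> V" using u unfolding \<delta>_def by blast
  obtain w p where w: "{w, u} \<in> E" "p \<in> paths_in V \<tau> w" "(\<Sum>x\<in>set p. d x) + load y u \<le> ?tot"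
    using inv u unfolding disk_invariant_def by blast
  obtain q where q: "q \<in> paths_in V \<tau> u" "set q \<subseteq> insert u (set p)"
    using path_append[OF w(2,1) uV] by blast
  have pV: "set p \<subseteq> V" using w(2) unfolding paths_in_def by auto
  have "(\<Sum>x\<in>set q. d x) \<le> (\<Sum>x\<in>insert u (set p). d x)"
    using q(2) nn pV uV by (intro sum_mono2) auto
  also have "\<dots> \<le> d u + (\<Sum>x\<in>set p. d x)"
    using nn[OF uV] by (simp add: sum.insert_if)
  finally have qc: "(\<Sum>x\<in>set q. d x) \<le> ?tot"
    using w(3) tight unfolding C1_tight_def by linarith
  show ?thesis
    unfolding disk_invariant_def
  proof (intro conjI)
    show "insert u S \<subseteq> V" "component (zero_verts d) \<tau> \<subseteq> insert u S"
      "\<forall>S'. 0 \<le> y S'" "\<forall>S'. y S' \<noteq> 0 \<longrightarrow> component (zero_verts d) \<tau> \<subseteq> S'"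
      "\<forall>v\<in>V. load y v \<le> d v"
      using inv uV unfolding disk_invariant_def by auto
    show "\<forall>v\<in>insert u S. \<exists>p\<in>paths_in V \<tau> v. (\<Sum>x\<in>set p. d x) \<le> ?tot"
      using inv qc q(1) unfolding disk_invariant_def by blast
    show "\<forall>v\<in>\<delta> (insert u S). \<exists>w. {w, v} \<in> E \<and>
        (\<exists>p\<in>paths_in V \<tau> w. (\<Sum>x\<in>set p. d x) + load y v \<le> ?tot)"
    proof
      fix v assume v: "v \<in> \<delta> (insert u S)"
      show "\<exists>w. {w, v} \<in> E \<and> (\<exists>p\<in>paths_in V \<tau> w. (\<Sum>x\<in>set p. d x) + load y v \<le> ?tot)"
      proof (cases "v \<in> \<delta> S")
        case True
        then show ?thesis using inv unfolding disk_invariant_def by blast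
      next
        case False
        then have "{u, v} \<in> E" "v \<in> V - S - \<delta> S" using v unfolding \<delta>_def by auto
        moreover from this(2) have "load y v = 0" using inv unfolding disk_invariant_def by blast
        ultimately show ?thesis using q(1) qc by auto
      qed
    qed
    have "V - insert u S - \<delta> (insert u S) \<subseteq> V - S - \<delta> S" unfolding \<delta>_def by auto
    then show "\<forall>v\<in>V - insert u S - \<delta> (insert u S). load y v = 0"
      using inv unfolding disk_invariant_def by blast
  qed
qed

lemma disk_growth_invariant:
  assumes "disk_growth d \<tau> S y" and \<tau>: "\<tau> \<in> zero_verts d"
    and nn: "\<And>v. v \<in> V \<Longrightarrow> 0 \<le> d v"
  shows "disk_invariant d \<tau> S y"
  using assms(1)
proof induction
  case start
  let ?C = "component (zero_verts d) \<tau>"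
  have CV: "?C \<subseteq> V" using connected_in_mem zero_verts_subset unfolding component_def by blast
  have path: "\<exists>p\<in>paths_in V \<tau> v. (\<Sum>x\<in>set p. d x) \<le> 0" if v: "v \<in> ?C" for v
  proof -
    obtain p where p: "p \<in> paths_in (zero_verts d) \<tau> v"
      using v unfolding component_def connected_in_def by auto
    then have sub: "set p \<subseteq> zero_verts d" and "p \<in> paths_in V \<tau> v"
      using zero_verts_subset unfolding paths_in_def by auto
    moreover have "(\<Sum>x\<in>set p. d x) = 0"
      using sub unfolding zero_verts_def by (intro sum.neutral) auto
    ultimately show ?thesis by (intro bexI[of _ p]) simp_all
  qed
  have "\<exists>w. {w, v} \<in> E \<and> (\<exists>p\<in>paths_in V \<tau> w. (\<Sum>x\<in>set p. d x) \<le> 0)" if "v \<in> \<delta> ?C" for v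
    using path that unfolding \<delta>_def by blast
  then show ?case
    unfolding disk_invariant_def load_def using CV path nn by simp
next
  case (grow S y y' u)
  then show ?case using disk_invariant_grow disk_invariant_raise nn by blast
qed

lemma is_disk_invariant:
  assumes "is_disk d \<tau> R y" "\<tau> \<in> zero_verts d" "\<And>v. v \<in> V \<Longrightarrow> 0 \<le> d v"
  shows "\<exists>S. disk_invariant d \<tau> S y" "(\<Sum>S\<in>Pow V. y S) = R"
  using assms disk_growth_invariant disk_invariant_raise unfolding is_disk_def by blast+

section \<open>One iteration of the algorithm\<close>

lemma residual_cost_nonneg: "v \<in> V \<Longrightarrow> 0 \<le> residual_cost X v"
  unfolding residual_cost_def using cost_nonneg by auto

lemma zero_verts_residual_cost:
  assumes "X \<subseteq> V" "zero_verts c \<subseteq> X"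
  shows "zero_verts (residual_cost X) = X"
  using assms unfolding zero_verts_def residual_cost_def by auto

lemma opt_attained: "\<exists>X. X \<subseteq> V \<and> opt = pcsf X"
proof -
  have "opt \<in> pcsf ` Pow V"
    unfolding opt_def using finite_V by (intro Min_in) auto
  then show ?thesis by auto
qed

text \<open>Every new core contains an old one, and choosing one such old core is injective. All
  members of \<open>K\<close> end up in the component of \<open>v\<close>, so at most one of them is
  chosen.\<close>

lemma card_cores_merge:
  assumes X: "X \<subseteq> X'" "X' \<subseteq> V" "zero_verts c \<subseteq> X" "endpoints L \<subseteq> X"
    and L': "L' \<subseteq> L"
    and K: "K \<subseteq> cores (residual_cost X) L"
    and merged: "\<And>C. C \<in> K \<Longrightarrow> \<exists>x\<in>C. connected_in X' x v"
  shows "card (cores (residual_cost X') L') + card K \<le> card (cores (residual_cost X) L) + 1"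
proof -
  let ?D = "cores (residual_cost X) L" and ?D' = "cores (residual_cost X') L'"
  have Z: "zero_verts (residual_cost X) = X" "zero_verts (residual_cost X') = X'"
    using X zero_verts_residual_cost by auto
  have "\<forall>C'\<in>?D'. \<exists>C\<in>?D. C \<subseteq> C'"
  proof
    fix C' assume C': "C' \<in> ?D'"
    then obtain x where x: "x \<in> C'" "x \<in> endpoints L'" unfolding cores_def by blast
    then have "x \<in> endpoints L" using L' unfolding endpoints_def by blast
    then have "component X x \<in> ?D" using endpoint_core[of x L "residual_cost X"] Z X(4) by auto
    moreover have "component X x \<subseteq> C'"
      unfolding core_eq_component[OF C' x(1)] Z component_def using connected_in_mono X(1) by blast
    ultimately show "\<exists>C\<in>?D. C \<subseteq> C'" by blast
  qed
  then obtain g where g: "\<And>C'. C' \<in> ?D' \<Longrightarrow> g C' \<in> ?D \<and> g C' \<subseteq> C'" by metis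
  have inj: "inj_on g ?D'"
  proof (rule inj_onI)
    fix A B assume AB: "A \<in> ?D'" "B \<in> ?D'" "g A = g B"
    then obtain x where "x \<in> g A" using g core_nonempty by blast
    then show "A = B" using AB g cores_disjoint[OF AB(1,2)] by blast
  qed
  have eq: "C' = component X' v" if C': "C' \<in> ?D'" "g C' \<in> K" for C'
  proof -
    obtain x where "x \<in> C'" "connected_in X' x v"
      using merged[OF C'(2)] g[OF C'(1)] by blast
    then show ?thesis using core_eq_component[OF C'(1)] component_eq Z by metis
  qed
  have finD: "finite ?D" "finite ?D'" by (rule finite_cores)+
  have "g ` ?D' \<inter> K \<subseteq> {g (component X' v)}" using eq by blast
  then have 1: "card (g ` ?D' \<inter> K) \<le> 1"
    using card_mono[of "{g (component X' v)}"] by simp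
  have "card ?D' = card (g ` ?D')" using inj by (simp add: card_image)
  also have "\<dots> = card (g ` ?D' - K) + card (g ` ?D' \<inter> K)"
    using finD by (simp add: card_Diff_subset_Int card_mono)
  also have "\<dots> \<le> card (?D - K) + 1"
    using 1 g finD by (intro add_mono card_mono) auto
  also have "card (?D - K) = card ?D - card K"
    using K finD finite_subset by (intro card_Diff_subset) auto
  finally show ?thesis using card_mono[OF finD(1) K] by linarith
qed

end

text \<open>The disks that sum to \<open>y\<close> are only known to exist. The locale fixes one
  choice \<open>Y\<close> of them together with the state of the algorithm.\<close>

locale pcsf_iteration = pcsf_instance V E c h s t \<pi>
  for V :: "'v set" and E :: "'v set set" and c :: "'v \<Rightarrow> real"
    and h :: nat and s t :: "nat \<Rightarrow> 'v" and \<pi> :: "nat \<Rightarrow> real" +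
  fixes X :: "'v set" and L :: "nat set" and T :: "'v set" and R :: real
    and y :: "'v set \<Rightarrow> real" and Y :: "'v \<Rightarrow> 'v set \<Rightarrow> real"
  assumes X_subset: "X \<subseteq> V" and terminals_subset: "terminals \<subseteq> X" and zero_subset: "zero_verts c \<subseteq> X"
    and L_subset: "L \<subseteq> {1..h}"
    and reps: "core_representatives (residual_cost X) L T"
    and disks: "\<And>\<tau>. \<tau> \<in> T \<Longrightarrow> is_disk (residual_cost X) \<tau> R (Y \<tau>)"
    and y_eq: "y = (\<lambda>S. \<Sum>\<tau>\<in>T. Y \<tau> S)"
    and feasible: "dual_feasible (residual_cost X) L y"
begin

abbreviation "d \<equiv> residual_cost X"

lemma zero_verts_d: "zero_verts d = X"
  by (rule zero_verts_residual_cost[OF X_subset zero_subset])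

lemma d_nonneg: "v \<in> V \<Longrightarrow> 0 \<le> d v"
  by (rule residual_cost_nonneg)

lemma endpoints_subset: "endpoints L \<subseteq> X"
  using L_subset terminals_subset unfolding terminals_def endpoints_def by auto

section \<open>Centers and cores\<close>

lemma T_subset: "T \<subseteq> X"
  using reps terminals_subset unfolding core_representatives_def by blast

lemma finite_T: "finite T"
  by (rule finite_subset[OF _ finite_V]) (use T_subset X_subset in auto)

lemma in_own_core: "\<tau> \<in> T \<Longrightarrow> \<tau> \<in> component X \<tau>"
  using T_subset connected_in_refl[of \<tau> X] unfolding component_def by auto

lemma center_core: "\<tau> \<in> T \<Longrightarrow> component X \<tau> \<in> cores d L"
proof -
  assume "\<tau> \<in> T"
  then obtain C where C: "C \<in> cores d L" "\<tau> \<in> C"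
    using reps unfolding core_representatives_def by blast
  then show ?thesis using core_eq_component[OF C] zero_verts_d by simp
qed

lemma core_center_unique:
  assumes "\<sigma> \<in> T" "\<tau> \<in> T" "component X \<sigma> = component X \<tau>"
  shows "\<sigma> = \<tau>"
proof -
  have "\<exists>!\<rho>. \<rho> \<in> T \<inter> component X \<tau>"
    using reps center_core[OF assms(2)] unfolding core_representatives_def by blast
  moreover have "\<sigma> \<in> T \<inter> component X \<tau>" "\<tau> \<in> T \<inter> component X \<tau>"
    using in_own_core[of \<sigma>] in_own_core[of \<tau>] assms by auto
  ultimately show ?thesis by blast
qed

lemma inj_component: "inj_on (component X) T"
  using core_center_unique by (intro inj_onI)

lemma card_T: "card T = card (cores d L)"
proof -
  have "component X ` T = cores d L"
  proof
    show "component X ` T \<subseteq> cores d L" using center_core by blast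
    show "cores d L \<subseteq> component X ` T"
    proof
      fix C assume C: "C \<in> cores d L"
      then obtain \<tau> where \<tau>: "\<tau> \<in> T" "\<tau> \<in> C"
        using reps unfolding core_representatives_def by blast
      then show "C \<in> component X ` T" using core_eq_component[OF C \<tau>(2)] zero_verts_d by simp
    qed
  qed
  then show ?thesis using card_image[OF inj_component] by simp
qed

section \<open>Supports of the disks and the bound on the radius\<close>

lemma disk_inv: "\<exists>S. disk_invariant d \<tau> S (Y \<tau>)"
  and disk_total: "(\<Sum>S\<in>Pow V. Y \<tau> S) = R"
  if "\<tau> \<in> T"
proof -
  have "\<tau> \<in> zero_verts d" using that T_subset zero_verts_d by auto
  from is_disk_invariant[OF disks[OF that] this d_nonneg]
  show "\<exists>S. disk_invariant d \<tau> S (Y \<tau>)" "(\<Sum>S\<in>Pow V. Y \<tau> S) = R"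
    by blast+
qed

lemma Y_nonneg: "\<tau> \<in> T \<Longrightarrow> 0 \<le> Y \<tau> S"
  using disk_inv unfolding disk_invariant_def by blast

text \<open>Nonnegative summands cannot cancel, so a set carried by one disk is carried by
  \<open>y\<close>, and feasibility of the union puts it into the core family.\<close>

lemma Y_support:
  assumes "\<tau> \<in> T" "Y \<tau> S \<noteq> 0"
  shows "S \<in> core_family d L \<and> component X \<tau> \<subseteq> S"
proof
  show "component X \<tau> \<subseteq> S"
    using disk_inv[OF assms(1)] assms(2) zero_verts_d unfolding disk_invariant_def by auto
  have "y S \<noteq> 0"
    unfolding y_eq using assms Y_nonneg finite_T by (auto simp: sum_nonneg_eq_0_iff)
  then show "S \<in> core_family d L" using feasible unfolding dual_feasible_def by blast
qed

lemma Y_support_other: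
  assumes "\<sigma> \<in> T" "\<tau> \<in> T" "\<sigma> \<noteq> \<tau>" "Y \<sigma> S \<noteq> 0"
  shows "component X \<tau> \<inter> S = {}"
proof (rule ccontr)
  assume ne: "component X \<tau> \<inter> S \<noteq> {}"
  have "component X \<sigma> = component X \<tau>"
    using ne Y_support[OF assms(1,4)] center_core[OF assms(1)] center_core[OF assms(2)]
      in_own_core[OF assms(1)] by (intro core_family_unique[of S d L]) auto
  then show False using core_center_unique assms by blast
qed

lemma load_sum: "load y v = (\<Sum>\<tau>\<in>T. load (Y \<tau>) v)"
  unfolding load_def y_eq by (rule sum.swap)

text \<open>Weak duality is applied to an optimal set of the original instance; lowering costs and
  dropping demands only decreases its value.\<close>

lemma card_T_R_le_opt: "real (card T) * R \<le> opt"
proof -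
  obtain A where A: "A \<subseteq> V" "opt = pcsf A" using opt_attained by blast
  have "(\<Sum>S\<in>Pow V. y S) = (\<Sum>\<tau>\<in>T. \<Sum>S\<in>Pow V. Y \<tau> S)"
    unfolding y_eq by (rule sum.swap)
  then have "real (card T) * R = (\<Sum>S\<in>Pow V. y S)"
    using disk_total by simp
  also have "\<dots> \<le> (\<Sum>v\<in>A. d v) + (\<Sum>i | i \<in> L \<and> \<not> connected_in A (s i) (t i). \<pi> i)"
    using feasible L_subset A endpoints_subset zero_verts_d by (intro weak_duality) auto
  also have "\<dots> \<le> pcsf A"
    unfolding pcsf_def using A L_subset cost_nonneg penalty_nonneg
    by (intro add_mono sum_mono sum_mono2) (auto simp: residual_cost_def)
  finally show ?thesis using A by simp
qed

text \<open>A set carried by either disk contains its own center but not the other one, so its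
  neighborhood meets \<open>A\<close>. The total value \<open>2 R\<close> of the two disks is
  therefore load on \<open>A\<close>, which (C1) bounds by the cost.\<close>

lemma center_distance:
  assumes \<sigma>\<tau>: "\<sigma> \<in> T" "\<tau> \<in> T" "\<sigma> \<noteq> \<tau>" and A: "connected_in A \<sigma> \<tau>" "A \<subseteq> V"
  shows "2 * R \<le> (\<Sum>v\<in>A. d v)"
proof -
  let ?H = "{S. S \<subseteq> V \<and> \<delta> S \<inter> A \<noteq> {}}"
  have cross: "\<delta> S \<inter> A \<noteq> {}" if "Y \<sigma> S + Y \<tau> S \<noteq> 0" for S
  proof (cases "Y \<sigma> S = 0")
    case True
    then have "Y \<tau> S \<noteq> 0" using that by simp
    then have "\<tau> \<in> S" "\<sigma> \<notin> S"
      using Y_support[of \<tau> S] Y_support_other[of \<tau> \<sigma> S] in_own_core \<sigma>\<tau> by auto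
    then show ?thesis using connected_in_crossing[OF connected_in_sym[OF A(1)] _ _ A(2)] by blast
  next
    case False
    then have "\<sigma> \<in> S" "\<tau> \<notin> S"
      using Y_support[of \<sigma> S] Y_support_other[of \<sigma> \<tau> S] in_own_core \<sigma>\<tau> by auto
    then show ?thesis using connected_in_crossing[OF A(1) _ _ A(2)] by blast
  qed
  have "2 * R = (\<Sum>S\<in>Pow V. Y \<sigma> S + Y \<tau> S)"
    using disk_total \<sigma>\<tau> by (simp add: sum.distrib)
  also have "\<dots> = (\<Sum>S\<in>?H. Y \<sigma> S + Y \<tau> S)"
    using finite_V cross by (intro sum.mono_neutral_right) auto
  also have "\<dots> \<le> (\<Sum>S\<in>?H. y S)"
  proof (rule sum_mono)
    fix S
    have "Y \<sigma> S + Y \<tau> S = (\<Sum>\<rho>\<in>{\<sigma>, \<tau>}. Y \<rho> S)" using \<sigma>\<tau> by simp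
    also have "\<dots> \<le> y S" unfolding y_eq using \<sigma>\<tau> finite_T Y_nonneg by (intro sum_mono2) auto
    finally show "Y \<sigma> S + Y \<tau> S \<le> y S" .
  qed
  also have "\<dots> \<le> (\<Sum>v\<in>A. load y v)"
    using feasible A finite_V finite_subset unfolding dual_feasible_def
    by (intro hitting_sum_le_load) auto
  also have "\<dots> \<le> (\<Sum>v\<in>A. d v)"
    using feasible A unfolding dual_feasible_def by (intro sum_mono) auto
  finally show ?thesis .
qed

section \<open>Discarding a core\<close>

text \<open>Only the disk of \<open>\<tau>\<close> contributes to the left side of (C2), so half of
  the penalty separated by \<open>S\<close> is at most \<open>R\<close>. A discarded demand not
  connected in \<open>X\<close> has exactly one endpoint in the core, and \<open>S\<close> contains
  no endpoint outside the core, so \<open>S\<close> separates it.\<close>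

lemma discarded_penalty:
  assumes \<tau>: "\<tau> \<in> T" and sub: "component X \<tau> \<subseteq> S" and tight: "C2_tight d L y S"
  shows "(\<Sum>i | i \<in> L \<and> (s i \<in> component X \<tau> \<or> t i \<in> component X \<tau>) \<and>
      \<not> connected_in X (s i) (t i). \<pi> i) \<le> 2 * R"
proof -
  let ?C = "component X \<tau>"
  have S: "S \<in> core_family d L" and eq: "core_load d L y S = half_penalty L S"
    using tight unfolding C2_tight_def by auto
  have SV: "S \<subseteq> V" using S unfolding core_family_def by blast
  have core: "core_of d L S = ?C" using core_of_eq[OF S center_core[OF \<tau>] sub] .
  have "core_load d L y S = (\<Sum>S' | ?C \<subseteq> S' \<and> S' \<subseteq> S. Y \<tau> S')"
    unfolding core_load_def core
  proof (rule sum.cong[OF refl])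
    fix S' assume "S' \<in> {S'. ?C \<subseteq> S' \<and> S' \<subseteq> S}"
    then have "Y \<sigma> S' = 0" if "\<sigma> \<in> T - {\<tau>}" for \<sigma>
      using Y_support_other[of \<sigma> \<tau> S'] that \<tau> in_own_core[OF \<tau>] by blast
    then show "y S' = Y \<tau> S'"
      unfolding y_eq using finite_T \<tau> by (simp add: sum.remove)
  qed
  also have "\<dots> \<le> (\<Sum>S'\<in>Pow V. Y \<tau> S')"
    using SV finite_V Y_nonneg[OF \<tau>] by (intro sum_mono2) auto
  also have "\<dots> = R" by (rule disk_total[OF \<tau>])
  finally have le: "(\<Sum>i | i \<in> L \<and> separates S i. \<pi> i) \<le> 2 * R"
    unfolding eq half_penalty_def by simp
  have in_C: "x \<in> ?C" if "x \<in> S" "x \<in> endpoints L" for x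
  proof -
    have x: "component X x \<in> cores d L" "x \<in> component X x"
      using that endpoint_core[of x L d] in_component_self[of x d] endpoints_subset
      unfolding zero_verts_d by auto
    have "component X x = ?C"
      using x that sub in_own_core[OF \<tau>]
      by (intro core_family_unique[OF S _ center_core[OF \<tau>]]) auto
    with x show ?thesis by simp
  qed
  have "separates S i"
    if i: "i \<in> L" "s i \<in> ?C \<or> t i \<in> ?C" "\<not> connected_in X (s i) (t i)" for i
  proof -
    have e: "s i \<in> endpoints L" "t i \<in> endpoints L" using i unfolding endpoints_def by auto
    have "\<not> (s i \<in> ?C \<and> t i \<in> ?C)"
      using i(3) connected_in_sym connected_in_trans unfolding component_def by blast
    then show ?thesis using in_C[OF _ e(1)] in_C[OF _ e(2)] i(2) sub unfolding separates_def by blast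
  qed
  then have "(\<Sum>i | i \<in> L \<and> (s i \<in> ?C \<or> t i \<in> ?C) \<and> \<not> connected_in X (s i) (t i). \<pi> i)
      \<le> (\<Sum>i | i \<in> L \<and> separates S i. \<pi> i)"
    using L_subset penalty_nonneg finite_subset[OF L_subset] by (intro sum_mono2) auto
  then show ?thesis using le by linarith
qed

lemma card_cores_discard:
  assumes \<tau>: "\<tau> \<in> T"
  shows "card (cores d (L - {i. s i \<in> component X \<tau> \<or> t i \<in> component X \<tau>})) < card (cores d L)"
proof (rule psubset_card_mono[OF finite_cores])
  let ?L' = "L - {i. s i \<in> component X \<tau> \<or> t i \<in> component X \<tau>}"
  have "component X \<tau> \<notin> cores d ?L'" unfolding cores_def endpoints_def by auto
  moreover have "cores d ?L' \<subseteq> cores d L" unfolding cores_def endpoints_def by auto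
  ultimately show "cores d ?L' \<subset> cores d L" using center_core[OF \<tau>] by blast
qed

section \<open>Joining disks at a tight vertex\<close>

lemma path_cost_le:
  assumes "p \<in> paths_in V a w" "{w, v} \<in> E" "v \<in> V" "shortest_path d a v q"
  shows "(\<Sum>x\<in>set q. d x) \<le> (\<Sum>x\<in>set p. d x) + d v"
proof -
  obtain r where r: "r \<in> paths_in V a v" "set r \<subseteq> insert v (set p)"
    using path_append[OF assms(1,2,3)] by blast
  have pV: "set p \<subseteq> V" using assms(1) unfolding paths_in_def by auto
  have "(\<Sum>x\<in>set q. d x) \<le> (\<Sum>x\<in>set r. d x)"
    using r(1) assms(4) unfolding shortest_path_def by blast
  also have "\<dots> \<le> (\<Sum>x\<in>insert v (set p). d x)"
    using r(2) d_nonneg pV assms(3) by (intro sum_mono2) auto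
  also have "\<dots> \<le> (\<Sum>x\<in>set p. d x) + d v"
    using d_nonneg[OF assms(3)] by (simp add: sum.insert_if)
  finally show ?thesis .
qed

lemma boundary_path:
  assumes "v \<in> boundary d \<tau> R"
  obtains u p where "{u, v} \<in> E" "p \<in> paths_in V \<tau> u" "(\<Sum>x\<in>set p. d x) \<le> R"
proof -
  obtain u where u: "{u, v} \<in> E" "vdist d \<tau> u \<le> ereal R"
    using assms unfolding boundary_def by blast
  have "vdist d \<tau> u < \<infinity>" by (rule order_le_less_trans[OF u(2)]) simp
  then obtain p where "p \<in> paths_in V \<tau> u" "vdist d \<tau> u = ereal (\<Sum>x\<in>set p. d x)"
    using vdist_attained by blast
  then show thesis using that u by auto
qed

text \<open>
  Otherwise the centers of the two disks would be joined at cost less than twice the radius,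
  contradicting feasibility.
\<close>

lemma boundary_not_inside:
  assumes "\<sigma> \<in> T" "\<tau> \<in> T" "v \<in> boundary d \<sigma> R"
  shows "v \<notin> inside d \<tau> R"
proof
  assume v: "v \<in> inside d \<tau> R"
  have ne: "\<tau> \<noteq> \<sigma>" using v assms(3) unfolding boundary_def by blast
  have "vdist d \<tau> v < ereal R" using v unfolding inside_def by blast
  moreover from this have "vdist d \<tau> v < \<infinity>" by auto
  ultimately obtain p where p: "p \<in> paths_in V \<tau> v" "(\<Sum>x\<in>set p. d x) < R"
    using vdist_attained by force
  obtain u q where q: "{u, v} \<in> E" "q \<in> paths_in V \<sigma> u" "(\<Sum>x\<in>set q. d x) \<le> R"
    using boundary_path[OF assms(3)] .
  let ?A = "set p \<union> set q"
  have AV: "?A \<subseteq> V" using p(1) q(2) unfolding paths_in_def by auto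
  have \<tau>v: "connected_in ?A \<tau> v" and \<sigma>u: "connected_in ?A \<sigma> u"
    using path_connected_in[OF p(1), of ?A] path_connected_in[OF q(2), of ?A] by auto
  have "connected_in ?A \<tau> u"
    using connected_in_step[OF \<tau>v, of u] q(1) connected_in_mem[OF \<sigma>u] by (simp add: insert_commute)
  then have "connected_in ?A \<tau> \<sigma>" using connected_in_trans connected_in_sym[OF \<sigma>u] by blast
  then have "2 * R \<le> (\<Sum>x\<in>?A. d x)"
    using center_distance assms ne AV by blast
  also have "\<dots> \<le> (\<Sum>x\<in>set p. d x) + (\<Sum>x\<in>set q. d x)"
  proof -
    have "0 \<le> (\<Sum>x\<in>set p \<inter> set q. d x)" using d_nonneg AV by (intro sum_nonneg) auto
    then show ?thesis by (simp add: sum_Un)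
  qed
  finally show False using p(2) q(3) by linarith
qed

text \<open>By the invariant, a vertex that carries load has a neighbor within distance
  \<open>R\<close> or is the center itself.\<close>

lemma load_off_boundary:
  assumes \<tau>: "\<tau> \<in> T" and v: "v \<in> V" "v \<notin> inside d \<tau> R" "v \<notin> boundary d \<tau> R"
  shows "load (Y \<tau>) v = 0"
proof -
  obtain S where S: "disk_invariant d \<tau> S (Y \<tau>)" using disk_inv[OF \<tau>] by blast
  have nb: "\<not> vdist d \<tau> w \<le> ereal R" if "{w, v} \<in> E" for w
    using v that edge_in_V[OF that] unfolding boundary_def by blast
  consider "v \<in> S" | "v \<in> \<delta> S" | "v \<in> V - S - \<delta> S" using v(1) by blast
  then show ?thesis
  proof cases
    case 1
    then obtain p where p: "p \<in> paths_in V \<tau> v" "(\<Sum>x\<in>set p. d x) \<le> R"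
      using S disk_total[OF \<tau>] unfolding disk_invariant_def by auto
    have pV: "set p \<subseteq> V" using p(1) unfolding paths_in_def by auto
    show ?thesis
    proof (cases "butlast p = []")
      \<comment> \<open>The path is the single vertex \<open>\<tau>\<close>. A center has residual
        cost zero, so (C1) leaves no room for load.\<close>
      case True
      then have "v = \<tau>" using p(1) unfolding paths_in_def by (cases p) (auto split: if_splits)
      then have "d v = 0" using \<tau> T_subset unfolding residual_cost_def by auto
      moreover have "load (Y \<tau>) v \<le> d v" using S v(1) unfolding disk_invariant_def by blast
      moreover have "0 \<le> load (Y \<tau>) v" unfolding load_def using Y_nonneg[OF \<tau>] by (rule sum_nonneg)
      ultimately show ?thesis by linarith
    next
      case False
      \<comment> \<open>The predecessor of \<open>v\<close> on the path is within distance
        \<open>R\<close>, which would put \<open>v\<close> on the boundary.\<close>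
      define w where "w = last (butlast p)"
      have "p = butlast p @ [v]" using p(1) unfolding paths_in_def by auto
      then have "p = butlast (butlast p) @ [w, v]" using False unfolding w_def
        by (metis append_butlast_last_id append.assoc append_Cons append_Nil)
      then have wv: "{w, v} \<in> E" "w \<in> set p"
        using p(1) unfolding paths_in_def
        by (metis (mono_tags, lifting) mem_Collect_eq successively_append_iff successively.simps(3),
            metis in_set_conv_decomp)
      obtain q where q: "q \<in> paths_in V \<tau> w" "set q \<subseteq> set p"
        using path_prefix[OF p(1) wv(2)] by blast
      have "(\<Sum>x\<in>set q. d x) \<le> (\<Sum>x\<in>set p. d x)"
        using q(2) pV d_nonneg by (intro sum_mono2) auto
      then have "vdist d \<tau> w \<le> ereal R"
        using vdist_le[OF q(1), of d] p(2) by (meson ereal_less_eq(3) order_trans)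
      then show ?thesis using nb wv by blast
    qed
  next
    case 2
    then obtain w p where w: "{w, v} \<in> E" "p \<in> paths_in V \<tau> w"
      "(\<Sum>x\<in>set p. d x) + load (Y \<tau>) v \<le> R"
      using S disk_total[OF \<tau>] unfolding disk_invariant_def by auto
    have "0 \<le> load (Y \<tau>) v" unfolding load_def using Y_nonneg[OF \<tau>] by (rule sum_nonneg)
    then have "vdist d \<tau> w \<le> ereal R"
      using vdist_le[OF w(2), of d] w(3) by (smt (verit) ereal_less_eq(3) order_trans)
    then show ?thesis using nb w by blast
  next
    case 3
    then show ?thesis using S unfolding disk_invariant_def by blast
  qed
qed

text \<open>The term \<open>d v\<close> appears because the path cost includes its end
  \<open>v\<close>. The cases follow the invariant: if \<open>v\<close> has been absorbed, the path
  fits into \<open>R\<close> and the load is at most \<open>d v\<close>; if \<open>v\<close> is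
  adjacent, the invariant gives the bound at a neighbor; otherwise the load is zero and the boundary
  supplies the neighbor.\<close>

lemma shortest_path_load_le:
  assumes \<tau>: "\<tau> \<in> T" and v: "v \<in> V" "v \<in> boundary d \<tau> R" and q: "shortest_path d \<tau> v q"
  shows "(\<Sum>x\<in>set q. d x) + load (Y \<tau>) v \<le> R + d v"
proof -
  obtain S where S: "disk_invariant d \<tau> S (Y \<tau>)" using disk_inv[OF \<tau>] by blast
  consider "v \<in> S" | "v \<in> \<delta> S" | "v \<in> V - S - \<delta> S" using v(1) by blast
  then show ?thesis
  proof cases
    case 1
    then obtain p where p: "p \<in> paths_in V \<tau> v" "(\<Sum>x\<in>set p. d x) \<le> R"
      using S disk_total[OF \<tau>] unfolding disk_invariant_def by auto
    have "(\<Sum>x\<in>set q. d x) \<le> R" using q p unfolding shortest_path_def by force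
    moreover have "load (Y \<tau>) v \<le> d v" using S v(1) unfolding disk_invariant_def by blast
    ultimately show ?thesis by linarith
  next
    case 2
    then obtain w p where w: "{w, v} \<in> E" "p \<in> paths_in V \<tau> w"
      "(\<Sum>x\<in>set p. d x) + load (Y \<tau>) v \<le> R"
      using S disk_total[OF \<tau>] unfolding disk_invariant_def by auto
    then show ?thesis using path_cost_le[OF w(2,1) v(1) q] by linarith
  next
    case 3
    then have "load (Y \<tau>) v = 0" using S unfolding disk_invariant_def by blast
    moreover obtain u p where "{u, v} \<in> E" "p \<in> paths_in V \<tau> u" "(\<Sum>x\<in>set p. d x) \<le> R"
      using boundary_path[OF v(2)] .
    ultimately show ?thesis using path_cost_le[of p \<tau> u v q] v(1) q by linarith
  qed
qed

text \<open>
  The path from \<open>\<tau>\<close> to \<open>v\<close> costs at most \<open>R\<close> minus the load that the disk of \<open>\<tau>\<close> puts on \<open>v\<close>,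
  not counting \<open>v\<close> itself, and by tightness these loads add up to the cost of \<open>v\<close>.
\<close>

lemma connecting_cost:
  assumes v: "v \<in> V" and tight: "C1_tight d y v" and B: "B = {\<tau> \<in> T. v \<in> boundary d \<tau> R}"
    and ne: "B \<noteq> {}" and P: "\<And>\<tau>. \<tau> \<in> B \<Longrightarrow> shortest_path d \<tau> v (P \<tau>)"
  shows "(\<Sum>x\<in>(\<Union>\<tau>\<in>B. set (P \<tau>)). d x) \<le> real (card B) * R"
proof -
  have finB: "finite B" using finite_T B by auto
  have BT: "B \<subseteq> T" using B by auto
  have PV: "set (P \<tau>) \<subseteq> V" "v \<in> set (P \<tau>)" if "\<tau> \<in> B" for \<tau>
    using P[OF that] unfolding shortest_path_def paths_in_def by auto
  \<comment> \<open>Splitting off the common end \<open>v\<close> makes its cost count once rather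
    than once per path.\<close>
  have un: "(\<Union>\<tau>\<in>B. set (P \<tau>)) = insert v (\<Union>\<tau>\<in>B. set (P \<tau>) - {v})" using ne PV(2) by blast
  have "(\<Sum>x\<in>(\<Union>\<tau>\<in>B. set (P \<tau>)). d x) = d v + (\<Sum>x\<in>(\<Union>\<tau>\<in>B. set (P \<tau>) - {v}). d x)"
    unfolding un using finB by (subst sum.insert) auto
  also have "\<dots> \<le> d v + (\<Sum>\<tau>\<in>B. \<Sum>x\<in>set (P \<tau>) - {v}. d x)"
    using finB PV(1) d_nonneg by (intro add_left_mono sum_UNION_le) auto
  also have "\<dots> \<le> d v + (\<Sum>\<tau>\<in>B. R - load (Y \<tau>) v)"
  proof (intro add_left_mono sum_mono)
    fix \<tau> assume \<tau>: "\<tau> \<in> B"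
    have "(\<Sum>x\<in>set (P \<tau>) - {v}. d x) = (\<Sum>x\<in>set (P \<tau>). d x) - d v"
      using PV(2)[OF \<tau>] by (simp add: sum_diff1)
    then show "(\<Sum>x\<in>set (P \<tau>) - {v}. d x) \<le> R - load (Y \<tau>) v"
      using shortest_path_load_le[of \<tau> v "P \<tau>"] \<tau> P B v by auto
  qed
  also have "\<dots> = real (card B) * R + (d v - (\<Sum>\<tau>\<in>B. load (Y \<tau>) v))"
    by (simp add: sum_subtractf)
  \<comment> \<open>Since \<open>v\<close> is on the boundary of some disk, it is inside none, so a
    disk outside \<open>B\<close> puts no load on it. Tightness for the whole union thus becomes
    tightness for the joined disks.\<close>
  also have "(\<Sum>\<tau>\<in>B. load (Y \<tau>) v) = (\<Sum>\<tau>\<in>T. load (Y \<tau>) v)"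
  proof (rule sum.mono_neutral_left[OF finite_T BT], safe)
    fix \<tau> assume \<tau>: "\<tau> \<in> T" "\<tau> \<notin> B"
    obtain \<sigma> where \<sigma>: "\<sigma> \<in> T" "v \<in> boundary d \<sigma> R" using ne B by blast
    show "load (Y \<tau>) v = 0"
      using load_off_boundary[OF \<tau>(1) v] boundary_not_inside[OF \<sigma>(1) \<tau>(1) \<sigma>(2)] \<tau> B by blast
  qed
  also have "\<dots> = d v" using tight load_sum unfolding C1_tight_def by simp
  finally show ?thesis by simp
qed

lemma card_cores_connect:
  assumes X': "X' = X \<union> (\<Union>\<tau>\<in>B. set (P \<tau>))" and B: "B \<subseteq> T" and L': "L' \<subseteq> L"
    and P: "\<And>\<tau>. \<tau> \<in> B \<Longrightarrow> shortest_path d \<tau> v (P \<tau>)"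
  shows "card (cores (residual_cost X') L') + card B \<le> card (cores d L) + 1"
proof -
  have card: "card (component X ` B) = card B"
    using inj_component B inj_on_subset card_image by blast
  have PV: "P \<tau> \<in> paths_in V \<tau> v" if "\<tau> \<in> B" for \<tau>
    using P[OF that] unfolding shortest_path_def by blast
  have "card (cores (residual_cost X') L') + card (component X ` B) \<le> card (cores d L) + 1"
  proof (rule card_cores_merge)
    show "X' \<subseteq> V" using X' X_subset PV unfolding paths_in_def by blast
    show "component X ` B \<subseteq> cores d L" using center_core B by blast
    fix C assume "C \<in> component X ` B"
    then obtain \<tau> where \<tau>: "\<tau> \<in> B" "C = component X \<tau>" by blast
    have "connected_in X' \<tau> v" using path_connected_in[OF PV[OF \<tau>(1)], of X'] X' \<tau>(1) by blast
    then show "\<exists>x\<in>C. connected_in X' x v" using \<tau> in_own_core B by blast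
  qed (use X' zero_subset endpoints_subset L' in auto)
  then show ?thesis using card by simp
qed

end

section \<open>The approximation guarantee\<close>

context pcsf_instance
begin

lemma reachable_invariant:
  assumes "reachable X L"
  shows "X \<subseteq> V \<and> terminals \<subseteq> X \<and> zero_verts c \<subseteq> X \<and> L \<subseteq> {1..h}"
  using assms
proof induction
  case init
  then show ?case
    using src_in_V tgt_in_V zero_verts_subset[of c] unfolding terminals_def endpoints_def by auto
next
  case (connect X L c' T R y v Lv P X' L')
  then have "set (P \<tau>) \<subseteq> V" if "\<tau> \<in> Lv" for \<tau>
    using that unfolding shortest_path_def paths_in_def by blast
  with connect show ?case by blast
qed blast

lemma iteration_disks_locale:
  assumes "reachable X L" "iteration_disks (residual_cost X) L T R y"
  shows "\<exists>Y. pcsf_iteration V E c h s t \<pi> X L T R y Y"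
proof -
  obtain Y where "\<forall>\<tau>\<in>T. is_disk (residual_cost X) \<tau> R (Y \<tau>)" "y = (\<lambda>S. \<Sum>\<tau>\<in>T. Y \<tau> S)"
    using assms(2) unfolding iteration_disks_def is_disk_union_def by blast
  then have "pcsf_iteration V E c h s t \<pi> X L T R y Y"
    using assms(2) reachable_invariant[OF assms(1)] unfolding iteration_disks_def
    by unfold_locales auto
  then show ?thesis by blast
qed

lemma opt_nonneg: "0 \<le> opt"
proof -
  obtain A where "A \<subseteq> V" "opt = pcsf A" using opt_attained by blast
  then show ?thesis
    unfolding pcsf_def using cost_nonneg penalty_nonneg
    by (auto intro!: add_nonneg_nonneg sum_nonneg)
qed

lemma card_cores_le: "card (cores d {1..h}) \<le> 2 * h"
proof -
  have "\<forall>C\<in>cores d {1..h}. \<exists>x. x \<in> C \<inter> endpoints {1..h}" unfolding cores_def by blast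
  then obtain g where g: "\<And>C. C \<in> cores d {1..h} \<Longrightarrow> g C \<in> C \<inter> endpoints {1..h}" by metis
  have "inj_on g (cores d {1..h})"
    by (rule inj_onI) (metis g cores_disjoint IntD1)
  then have "card (cores d {1..h}) \<le> card (endpoints {1..h})"
    using g by (intro card_inj_on_le[of g]) (auto simp: endpoints_def)
  also have "\<dots> \<le> card (s ` {1..h}) + card (t ` {1..h})"
    unfolding endpoints_def by (rule card_Un_le)
  also have "\<dots> \<le> 2 * h"
    using card_image_le[of "{1..h}" s] card_image_le[of "{1..h}" t] by simp
  finally show ?thesis .
qed

text \<open>A path of residual cost zero stays in \<open>X\<close>, which contains all vertices of
  cost zero. Demands dropped for having distance zero are thus connected by selected
  vertices.\<close>

lemma zero_vdist_connected:
  assumes X: "X \<subseteq> V" "zero_verts c \<subseteq> X" and 0: "vdist (residual_cost X) a b = 0"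
  shows "connected_in X a b"
proof -
  obtain p where p: "p \<in> paths_in V a b" "(\<Sum>x\<in>set p. residual_cost X x) = 0"
    using vdist_attained[of "residual_cost X" a b] 0 by auto
  have pV: "set p \<subseteq> V" using p(1) unfolding paths_in_def by auto
  have "residual_cost X x = 0" if "x \<in> set p" for x
    using p(2) that pV residual_cost_nonneg by (subst (asm) sum_nonneg_eq_0_iff) auto
  then have "set p \<subseteq> X"
    using zero_verts_residual_cost[OF X] pV unfolding zero_verts_def by blast
  then show ?thesis using path_connected_in p(1) by blast
qed

text \<open>A potential argument: the harmonic term is the budget still reserved for the remaining
  cores, and each iteration spends no more than its decrease. Penalties count only for dropped
  demands that the current \<open>X\<close> leaves unconnected.\<close>

lemma paid_cost_bound:
  assumes "reachable X L"
  shows "(\<Sum>v\<in>X. c v) + (\<Sum>i | i \<in> {1..h} - L \<and> \<not> connected_in X (s i) (t i). \<pi> i)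
    + 2 * harm (card (cores (residual_cost X) L)) * opt \<le> 2 * harm (2 * h) * opt"
  using assms
proof induction
  case init
  have "(\<Sum>v\<in>terminals \<union> zero_verts c. c v) = 0"
    using src_cost tgt_cost unfolding terminals_def endpoints_def zero_verts_def
    by (intro sum.neutral) auto
  then show ?case
    using card_cores_le opt_nonneg by (auto intro!: mult_right_mono harm_mono)
next
  case (discard X L c' T R y \<tau> S L')
  obtain Y where "pcsf_iteration V E c h s t \<pi> X L T R y Y"
    using iteration_disks_locale[of X L T R y] discard.hyps(1,3,4) by blast
  then interpret pcsf_iteration V E c h s t \<pi> X L T R y Y .
  let ?C = "component X \<tau>"
  let ?n = "card (cores d L)" and ?n' = "card (cores d L')"
  have sub: "?C \<subseteq> S" using discard.hyps(3,6) zero_verts_d unfolding continent_def by auto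
  have tight: "C2_tight d L y S" using discard.hyps(3,7) by simp
  then have S: "S \<in> core_family d L" unfolding C2_tight_def by blast
  have core: "core_of d L S = ?C"
    using core_of_eq[OF S center_core sub] discard.hyps(5) by blast
  have L': "L' = L - {i. s i \<in> ?C \<or> t i \<in> ?C}" using discard.hyps(3,8) core by simp
  let ?N = "{i. i \<in> {1..h} - L \<and> \<not> connected_in X (s i) (t i)}"
  let ?M = "{i. i \<in> L \<and> (s i \<in> ?C \<or> t i \<in> ?C) \<and> \<not> connected_in X (s i) (t i)}"
  have finM: "finite ?M" using finite_subset[OF L_subset] by simp
  \<comment> \<open>As \<open>X\<close> is unchanged, the only new penalties are those of the
    demands dropped now that \<open>X\<close> does not connect.\<close>
  have "{i. i \<in> {1..h} - L' \<and> \<not> connected_in X (s i) (t i)} = ?N \<union> ?M"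
    using L' L_subset by auto
  then have "(\<Sum>i | i \<in> {1..h} - L' \<and> \<not> connected_in X (s i) (t i). \<pi> i)
      = (\<Sum>i\<in>?N. \<pi> i) + (\<Sum>i\<in>?M. \<pi> i)"
    using finM by (simp add: sum.union_disjoint disjoint_iff)
  moreover have "(\<Sum>i\<in>?M. \<pi> i) \<le> 2 * R"
    by (rule discarded_penalty[OF discard.hyps(5) sub tight])
  moreover have "R \<le> (harm ?n - harm ?n') * opt"
  proof -
    have lt: "?n' < ?n" using card_cores_discard[OF discard.hyps(5)] L' by simp
    have "R \<le> opt / real ?n"
      using card_T_R_le_opt lt unfolding card_T by (simp add: field_simps)
    also have "\<dots> = 1 / real ?n * opt" by simp
    also have "\<dots> \<le> real (?n - ?n') / real ?n * opt"
      using lt opt_nonneg by (intro mult_right_mono divide_right_mono) auto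
    also have "\<dots> \<le> (harm ?n - harm ?n') * opt"
      using harm_diff_ge[of ?n' ?n] lt opt_nonneg by (intro mult_right_mono) auto
    finally show ?thesis .
  qed
  ultimately show ?case using discard.IH by (simp add: algebra_simps)
next
  case (connect X L c' T R y v B P X' L')
  obtain Y where "pcsf_iteration V E c h s t \<pi> X L T R y Y"
    using iteration_disks_locale[of X L T R y] connect.hyps(1,3,4) by blast
  then interpret pcsf_iteration V E c h s t \<pi> X L T R y Y .
  let ?n = "card (cores d L)" and ?n' = "card (cores (residual_cost X') L')" and ?m = "card B"
  have "reachable X' L'" by (rule reachable.connect[OF connect.hyps])
  then have X'V: "X' \<subseteq> V" "zero_verts c \<subseteq> X'" using reachable_invariant by blast+
  have P: "shortest_path d \<tau> v (P \<tau>)" if "\<tau> \<in> B" for \<tau> using connect.hyps(3,10) that by simp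
  have finX': "finite X'" using X'V finite_V finite_subset by blast
  have ne: "B \<noteq> {}" using connect.hyps(9) by auto
  have "(\<Sum>x\<in>X'. c x) = (\<Sum>x\<in>X. c x) + (\<Sum>x\<in>X' - X. c x)"
    using finX' connect.hyps(11) by (subst sum.subset_diff[of X X']) auto
  also have "(\<Sum>x\<in>X' - X. c x) = (\<Sum>x\<in>X' - X. d x)"
    by (rule sum.cong) (auto simp: residual_cost_def)
  also have "\<dots> \<le> (\<Sum>x\<in>(\<Union>\<tau>\<in>B. set (P \<tau>)). d x)"
    using X'V connect.hyps(11) finX' by (intro sum_mono2) (auto intro!: d_nonneg)
  also have "\<dots> \<le> real ?m * R"
    using connect.hyps(3,6-8) ne P by (intro connecting_cost[of v]) auto
  finally have cost: "(\<Sum>x\<in>X'. c x) \<le> (\<Sum>x\<in>X. c x) + real ?m * R" by simp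

  \<comment> \<open>Demands dropped now are connected in \<open>X'\<close>, and enlarging
    \<open>X\<close> can only connect further demands dropped earlier.\<close>
  have "{i. i \<in> {1..h} - L' \<and> \<not> connected_in X' (s i) (t i)}
      \<subseteq> {i. i \<in> {1..h} - L \<and> \<not> connected_in X (s i) (t i)}"
    using connect.hyps(11,12) zero_vdist_connected[OF X'V] connected_in_mono[of X _ _ X'] by blast
  then have pen: "(\<Sum>i | i \<in> {1..h} - L' \<and> \<not> connected_in X' (s i) (t i). \<pi> i)
      \<le> (\<Sum>i | i \<in> {1..h} - L \<and> \<not> connected_in X (s i) (t i). \<pi> i)"
    using penalty_nonneg by (intro sum_mono2) auto

  have BT: "B \<subseteq> T" using connect.hyps(8) by blast
  have n: "?n' + ?m \<le> ?n + 1"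
    using card_cores_connect[OF connect.hyps(11) BT _ P] connect.hyps(12) by blast
  have m: "2 \<le> ?m" by (rule connect.hyps(9))
  have "R \<le> opt / real ?n"
    using card_T_R_le_opt n m unfolding card_T by (simp add: field_simps)
  then have "real ?m * R \<le> real ?m * (opt / real ?n)" by (intro mult_left_mono) auto
  also have "\<dots> = 2 * ((real ?m / 2) / real ?n * opt)" by simp
  also have "\<dots> \<le> 2 * (real (?n - ?n') / real ?n * opt)"
    using n m opt_nonneg by (intro mult_left_mono mult_right_mono divide_right_mono) auto
  also have "\<dots> \<le> 2 * ((harm ?n - harm ?n') * opt)"
    using harm_diff_ge[of ?n' ?n] n m opt_nonneg by (intro mult_left_mono mult_right_mono) auto
  finally show ?case using cost pen connect.IH by (simp add: algebra_simps)
qed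

lemma algorithm_output_bound:
  assumes "algorithm_output X"
  shows "pcsf X \<le> 2 * harm (2 * h) * opt"
proof -
  have "0 \<le> 2 * harm (card (cores (residual_cost X) {})) * opt"
    using opt_nonneg by (simp add: harm_nonneg)
  moreover have "pcsf X + 2 * harm (card (cores (residual_cost X) {})) * opt \<le> 2 * harm (2 * h) * opt"
    using paid_cost_bound[of X "{}"] assms unfolding algorithm_output_def pcsf_def by simp
  ultimately show ?thesis by linarith
qed

end

theorem theorem2:
  fixes V :: "'v set" and E :: "'v set set" and c :: "'v \<Rightarrow> real"
    and h :: nat and s t :: "nat \<Rightarrow> 'v" and \<pi> :: "nat \<Rightarrow> real" and X :: "'v set"
  assumes "pcsf_instance V E c h s t \<pi>"
    and "pcsf_instance.algorithm_output V E c h s t \<pi> X"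
  shows "pcsf_instance.pcsf E c h s t \<pi> X
         \<le> 2 * harm (2 * h) * pcsf_instance.opt V E c h s t \<pi>"
  using pcsf_instance.algorithm_output_bound[OF assms] .

end
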